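(* Let $n\ge 1$, and let $M\subset 2\Delta\subset\mathbb{R}^n$ be a lattice polytope containing the point $O=\left(\frac{2}{n},\dots,\frac{2}{n}\right)$. Then a generic quadratic form $B\in\mathbb{C}^M$ is nondegenerate; that is, the set of degenerate quadratic forms in $\mathbb{C}^M$ is a proper algebraic subset of the finite-dimensional vector space $\mathbb{C}^M$.
   Context: For $i\in\{1,\dots,n\}$ let $A_i\in\mathbb{R}^n$ be the point whose $i$-th coordinate is $2$ and whose other coordinates are $0$, and let $2\Delta=\operatorname{conv}\{A_1,\dots,A_n\}$. A lattice polytope is the convex hull of a finite set of points of $\mathbb{Z}^n$. For a polynomial $p=\sum_k a_k z_1^{k_1}\cdots z_n^{k_n}\in\mathbb{C}[z_1,\dots,z_n]$, its Newton polytope is $N(p)=\operatorname{conv}\{k\in\mathbb{Z}^n\mid a_k\ne 0\}$. For a polytope $M$, $\mathbb{C}^M$ denotes the space of all polynomials $p\in\mathbb{C}[z_1,\dots,z_n]$ with $N(p)\subset M$; when $M\subset 2\Delta$, all elements of $\mathbb{C}^M$ are quadratic forms. A quadratic form $B=\sum_{i,j}B_{ij}z_iz_j$ with symmetric matrix $(B_{ij})$ is nondegenerate if $\det(B_{ij})\ne 0$, and degenerate otherwise. *)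

theory Defs
  imports "HOL-Analysis.Analysis" "HOL-Library.Poly_Mapping"
begin

text \<open>Polynomials over the complex numbers in variables indexed by \<open>'n\<close>: finitely supported maps from
  exponents (finitely supported maps \<open>'n \<Rightarrow> nat\<close>) to coefficients.  The multiplication of
  \<open>\<Rightarrow>\<^sub>0\<close> is the convolution product, i.e. the product of polynomials.\<close>

type_synonym 'n cpoly = "('n \<Rightarrow>\<^sub>0 nat) \<Rightarrow>\<^sub>0 complex"

definition Const :: "complex \<Rightarrow> 'n cpoly"
  where "Const c = Poly_Mapping.single 0 c"

definition Var :: "'n \<Rightarrow> 'n cpoly"
  where "Var i = Poly_Mapping.single (Poly_Mapping.single i 1) 1"

definition cscale :: "complex \<Rightarrow> 'n cpoly \<Rightarrow> 'n cpoly"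
  where "cscale c p = Const c * p"

interpretation cpoly: vector_space "cscale :: complex \<Rightarrow> 'n cpoly \<Rightarrow> 'n cpoly"
  by unfold_locales
    (simp_all add: cscale_def Const_def distrib_left distrib_right single_add
      mult_single flip: mult.assoc)

definition exponent_point :: "('n::finite \<Rightarrow>\<^sub>0 nat) \<Rightarrow> real ^ 'n"
  where "exponent_point k = (\<chi> i. real (Poly_Mapping.lookup k i))"

definition newton_polytope :: "'n::finite cpoly \<Rightarrow> (real ^ 'n) set"
  where "newton_polytope p = convex hull (exponent_point ` Poly_Mapping.keys p)"

definition polys_in :: "(real ^ 'n::finite) set \<Rightarrow> 'n cpoly set"
  where "polys_in M = {p. newton_polytope p \<subseteq> M}"

definition lattice_polytope :: "(real ^ 'n::finite) set \<Rightarrow> bool"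
  where "lattice_polytope M \<longleftrightarrow>
    (\<exists>S. finite S \<and> (\<forall>x\<in>S. \<forall>i. x $ i \<in> \<int>) \<and> M = convex hull S)"

definition two_simplex :: "(real ^ 'n::finite) set"
  where "two_simplex = convex hull (range (\<lambda>i. axis i 2))"

definition form_of_matrix :: "complex ^ 'n ^ 'n \<Rightarrow> 'n::finite cpoly"
  where "form_of_matrix B = (\<Sum>i\<in>UNIV. \<Sum>j\<in>UNIV. Const (B $ i $ j) * Var i * Var j)"

definition quadratic_form :: "'n::finite cpoly \<Rightarrow> bool"
  where "quadratic_form p \<longleftrightarrow> (\<exists>B. transpose B = B \<and> p = form_of_matrix B)"

text \<open>The symmetric matrix of a quadratic form is unique (its off-diagonal entries are half the
  coefficients of the mixed monomials), so the quantifier below ranges over one matrix only.\<close>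

definition nondegenerate :: "'n::finite cpoly \<Rightarrow> bool"
  where "nondegenerate p \<longleftrightarrow> (\<exists>B. transpose B = B \<and> p = form_of_matrix B \<and> det B \<noteq> 0)"

definition degenerate :: "'n::finite cpoly \<Rightarrow> bool"
  where "degenerate p \<longleftrightarrow> quadratic_form p \<and> \<not> nondegenerate p"

text \<open>Polynomial functions on a complex vector space with scalar multiplication \<open>s\<close>: the algebra of
  functions generated by the constants and the linear functionals.\<close>

inductive_set polynomial_functions ::
    "(complex \<Rightarrow> 'v::ab_group_add \<Rightarrow> 'v) \<Rightarrow> ('v \<Rightarrow> complex) set"
  for s :: "complex \<Rightarrow> 'v \<Rightarrow> 'v" where
  const: "(\<lambda>_. c) \<in> polynomial_functions s"
| linear: "Vector_Spaces.linear s (*) f \<Longrightarrow> f \<in> polynomial_functions s"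
| add: "f \<in> polynomial_functions s \<Longrightarrow> g \<in> polynomial_functions s \<Longrightarrow>
    (\<lambda>v. f v + g v) \<in> polynomial_functions s"
| mult: "f \<in> polynomial_functions s \<Longrightarrow> g \<in> polynomial_functions s \<Longrightarrow>
    (\<lambda>v. f v * g v) \<in> polynomial_functions s"

text \<open>Algebraic subsets of a subspace \<open>V\<close>.  Every linear functional on \<open>V\<close> extends to the whole
  type, so the restrictions to \<open>V\<close> of the functions above are exactly the polynomial functions
  on \<open>V\<close>.\<close>

definition algebraic_subset ::
    "(complex \<Rightarrow> 'v::ab_group_add \<Rightarrow> 'v) \<Rightarrow> 'v set \<Rightarrow> 'v set \<Rightarrow> bool"
  where "algebraic_subset s V S \<longleftrightarrow>
    (\<exists>F. F \<subseteq> polynomial_functions s \<and> S = {v \<in> V. \<forall>f\<in>F. f v = 0})"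

end

theory Submission imports Defs begin

text \<open>The lattice points of \<open>2\<Delta>\<close> are the points \<open>e\<^sub>i + e\<^sub>j\<close>, so a convex combination of lattice
  points of \<open>M\<close> that represents \<open>O\<close> is, after scaling by \<open>n / 2\<close>, a symmetric nonnegative matrix with
  row sums \<open>1\<close> supported on the pairs with \<open>e\<^sub>i + e\<^sub>j \<in> M\<close>.  Such a matrix \<open>W\<close> of minimal support is
  nonsingular: by minimality no nonzero symmetric matrix supported in the support of \<open>W\<close> has zero
  row sums.  If \<open>W u = 0\<close>, then \<open>(u\<^sub>i u\<^sub>j W\<^sub>i\<^sub>j)\<close> has zero row sums, hence vanishes, so \<open>W\<close> vanishes on
  \<open>U \<times> U\<close> for \<open>U\<close> the support of \<open>u\<close>.  In the bipartite graph that \<open>W\<close> induces between \<open>U\<close> and its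
  neighbourhood \<open>N\<close> every vertex has degree at least \<open>2\<close>, so there are at least \<open>card U + card N\<close>
  edges, too many for a weighting of the edges to be determined by its marginals.\<close>

section \<open>Quadratic forms and their matrices\<close>

abbreviation mon2 :: "'n \<Rightarrow> 'n \<Rightarrow> 'n \<Rightarrow>\<^sub>0 nat"
  where "mon2 i j \<equiv> Poly_Mapping.single i 1 + Poly_Mapping.single j 1"

lemma mon2_eq_iff: "mon2 a b = mon2 i j \<longleftrightarrow> (a = i \<and> b = j) \<or> (a = j \<and> b = i)"
proof
  assume eq: "mon2 a b = mon2 i j"
  have l: "(if a = x then 1 else 0) + (if b = x then 1 else 0)
      = (if i = x then 1 else 0) + (if j = x then 1 else (0::nat))" for x
    using arg_cong[OF eq, of "\<lambda>p. Poly_Mapping.lookup p x"]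
    by (simp only: lookup_add lookup_single when_def)
  show "(a = i \<and> b = j) \<or> (a = j \<and> b = i)"
  proof (cases "a = i")
    case True
    then show ?thesis
      using l[of b] by (auto split: if_splits)
  next
    case False
    then have "a = j"
      using l[of a] by (simp split: if_splits)
    then show ?thesis
      using l[of b] by (auto split: if_splits)
  qed
qed (auto simp: add.commute)

lemma cscale_lookup: "Poly_Mapping.lookup (cscale c p) k = c * Poly_Mapping.lookup p k"
proof -
  have "Poly_Mapping.single 0 c * p = Poly_Mapping.map ((*) c) p"
    by (simp add: mult_map_scale_conv_mult)
  then show ?thesis
    by (simp add: cscale_def Const_def map.rep_eq when_def)
qed

lemma linear_lookup: "Vector_Spaces.linear cscale (*) (\<lambda>p :: 'n cpoly. Poly_Mapping.lookup p k)"
  by unfold_locales (simp_all add: cscale_lookup lookup_add algebra_simps)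

lemma form_of_matrix_conv_monomials:
  "form_of_matrix B = (\<Sum>i\<in>UNIV. \<Sum>j\<in>UNIV. Poly_Mapping.single (mon2 i j) (B $ i $ j))"
  by (simp add: form_of_matrix_def Const_def Var_def mult_single)

lemma lookup_form_of_matrix:
  "Poly_Mapping.lookup (form_of_matrix B) k
    = (\<Sum>i\<in>UNIV. \<Sum>j\<in>UNIV. if mon2 i j = k then B $ i $ j else 0)"
  by (simp add: form_of_matrix_conv_monomials lookup_sum lookup_single when_def)

text \<open>The coefficient of a mixed monomial collects the two entries at (i, j) and (j, i), hence
  the factor 1/2 off the diagonal. The entries are linear in the coefficients of
  \<open>p\<close>.\<close>

definition matrix_of_form :: "'n::finite cpoly \<Rightarrow> complex ^ 'n ^ 'n"
  where "matrix_of_form p =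
    (\<chi> i j. (if i = j then 1 else 1 / 2) * Poly_Mapping.lookup p (mon2 i j))"

lemma matrix_of_form_symmetric: "transpose (matrix_of_form p) = matrix_of_form p"
  by (auto simp: matrix_of_form_def transpose_def vec_eq_iff add.commute)

lemma lookup_form_of_matrix_mon2:
  "Poly_Mapping.lookup (form_of_matrix B) (mon2 i j)
    = (if i = j then B $ i $ i else B $ i $ j + B $ j $ i)"
proof -
  have "Poly_Mapping.lookup (form_of_matrix B) (mon2 i j)
      = (\<Sum>(a, b)\<in>UNIV. if mon2 a b = mon2 i j then B $ a $ b else 0)"
    unfolding lookup_form_of_matrix by (simp add: sum.cartesian_product)
  \<comment> \<open>The index set collapses to one pair when i = j, which is why the diagonal is a
    separate case in the result.\<close>
  also have "\<dots> = (\<Sum>(a, b)\<in>{(i, j), (j, i)}. B $ a $ b)"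
    unfolding mon2_eq_iff by (rule sum.mono_neutral_cong_right) (auto split: if_splits)
  finally show ?thesis
    by auto
qed

lemma matrix_of_form_of_matrix:
  assumes "transpose B = B"
  shows "matrix_of_form (form_of_matrix B) = B"
proof -
  have "B $ j $ i = B $ i $ j" for i j
    using arg_cong[OF assms, of "\<lambda>A. A $ i $ j"] by (simp add: transpose_def)
  then show ?thesis
    by (simp add: matrix_of_form_def lookup_form_of_matrix_mon2 vec_eq_iff del: One_nat_def)
qed

lemma form_of_matrix_of_form:
  fixes p :: "'n::finite cpoly"
  assumes "\<And>k. k \<in> Poly_Mapping.keys p \<Longrightarrow> \<exists>i j. k = mon2 i j"
  shows "form_of_matrix (matrix_of_form p) = p"
proof (rule poly_mapping_eqI)
  fix k
  show "Poly_Mapping.lookup (form_of_matrix (matrix_of_form p)) k = Poly_Mapping.lookup p k"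
  proof (cases "\<exists>i j. k = mon2 i j")
    case True
    then obtain i j where k: "k = mon2 i j"
      by blast
    show ?thesis
      unfolding k lookup_form_of_matrix_mon2
      using mon2_eq_iff[of j i i j]
      by (simp add: matrix_of_form_def del: One_nat_def)
  next
    case False
    then have "k \<notin> Poly_Mapping.keys p"
      using assms by blast
    moreover have "mon2 i j \<noteq> k" for i j
      using False by blast
    then have "Poly_Mapping.lookup (form_of_matrix (matrix_of_form p)) k = 0"
      by (simp add: lookup_form_of_matrix del: One_nat_def)
    ultimately show ?thesis
      by (simp add: in_keys_iff)
  qed
qed

text \<open>Uniqueness of the symmetric matrix replaces the existential in
  \<open>nondegenerate\<close> by one determinant, which is polynomial in the coefficients.\<close>

lemma degenerate_iff_det:
  assumes "quadratic_form p"
  shows "degenerate p \<longleftrightarrow> det (matrix_of_form p) = 0"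
  using assms unfolding degenerate_def quadratic_form_def nondegenerate_def
  by (metis matrix_of_form_of_matrix)

section \<open>Polynomial functions\<close>

lemma polynomial_functions_sum:
  assumes "finite A" "\<And>a. a \<in> A \<Longrightarrow> f a \<in> polynomial_functions s"
  shows "(\<lambda>v. \<Sum>a\<in>A. f a v) \<in> polynomial_functions s"
  using assms
  by (induction A rule: finite_induct)
    (auto intro: polynomial_functions.const polynomial_functions.add)

lemma polynomial_functions_prod:
  assumes "finite A" "\<And>a. a \<in> A \<Longrightarrow> f a \<in> polynomial_functions s"
  shows "(\<lambda>v. \<Prod>a\<in>A. f a v) \<in> polynomial_functions s"
  using assms
  by (induction A rule: finite_induct)
    (auto intro: polynomial_functions.const polynomial_functions.mult)

lemma polynomial_functions_det:
  fixes A :: "'v::ab_group_add \<Rightarrow> complex ^ 'n ^ 'n"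
  assumes "\<And>i j. (\<lambda>v. A v $ i $ j) \<in> polynomial_functions s"
  shows "(\<lambda>v. det (A v)) \<in> polynomial_functions s"
  unfolding det_def
  by (rule polynomial_functions_sum, simp add: finite_permutations)
    (rule polynomial_functions.mult[OF polynomial_functions.const],
      rule polynomial_functions_prod[OF finite], rule assms)

lemma polynomial_functions_det_matrix_of_form:
  "(\<lambda>p :: 'n::finite cpoly. det (matrix_of_form p)) \<in> polynomial_functions cscale"
proof (rule polynomial_functions_det)
  fix i j
  show "(\<lambda>p :: 'n cpoly. matrix_of_form p $ i $ j) \<in> polynomial_functions cscale"
    unfolding matrix_of_form_def
    by (simp add: polynomial_functions.linear linear_lookup
        polynomial_functions.mult[OF polynomial_functions.const, of _ _ "1/2", simplified])
qed

section \<open>Lattice points of the simplex\<close>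

lemma two_simplex_D:
  fixes x :: "real ^ 'n::finite"
  assumes "x \<in> two_simplex"
  shows "0 \<le> x $ i" "(\<Sum>i\<in>UNIV. x $ i) = 2"
proof -
  let ?C = "{x :: real ^ 'n. (\<forall>i. 0 \<le> x $ i) \<and> (\<Sum>i\<in>UNIV. x $ i) = 2}"
  have "convex ?C"
    by (auto simp: convex_def sum.distrib simp flip: sum_distrib_left)
  moreover have "range (\<lambda>i :: 'n. axis i 2) \<subseteq> ?C"
    by (auto simp: axis_def)
  ultimately have "two_simplex \<subseteq> ?C"
    unfolding two_simplex_def by (rule hull_minimal[rotated])
  then show "0 \<le> x $ i" "(\<Sum>i\<in>UNIV. x $ i) = 2"
    using assms by auto
qed

text \<open>Some coordinate is positive, hence at least 1 by integrality, so a unit vector can be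
  split off. Doing this twice exhausts a lattice point of coordinate sum 2.\<close>

lemma lattice_point_minus_axis:
  fixes x :: "real ^ 'n::finite"
  assumes "\<And>i. x $ i \<in> \<int>" "\<And>i. 0 \<le> x $ i" "0 < (\<Sum>i\<in>UNIV. x $ i)"
  obtains i where "\<And>l. (x - axis i 1) $ l \<in> \<int>" "\<And>l. 0 \<le> (x - axis i 1) $ l"
    "(\<Sum>l\<in>UNIV. (x - axis i 1) $ l) = (\<Sum>l\<in>UNIV. x $ l) - 1"
proof -
  obtain i where "0 < x $ i"
    using assms(3) by (meson not_less sum_nonpos)
  moreover obtain m where "x $ i = of_int m"
    using assms(1) Ints_cases by blast
  ultimately have "1 \<le> x $ i"
    by simp
  with assms(1,2) show thesis
    by (intro that[of i]) (auto simp: axis_def sum_subtractf)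
qed

lemma lattice_point_two_simplex:
  fixes x :: "real ^ 'n::finite"
  assumes "x \<in> two_simplex" "\<And>i. x $ i \<in> \<int>"
  obtains i j where "x = axis i 1 + axis j 1"
proof -
  obtain i where i: "\<And>l. (x - axis i 1) $ l \<in> \<int>" "\<And>l. 0 \<le> (x - axis i 1) $ l"
    "(\<Sum>l\<in>UNIV. (x - axis i 1) $ l) = 1"
    by (rule lattice_point_minus_axis[of x]) (use assms two_simplex_D[OF assms(1)] in auto)
  obtain j where j: "\<And>l. 0 \<le> (x - axis i 1 - axis j 1) $ l"
    "(\<Sum>l\<in>UNIV. (x - axis i 1 - axis j 1) $ l) = 0"
    by (rule lattice_point_minus_axis[of "x - axis i 1"]) (use i in auto)
  then have "(x - axis i 1 - axis j 1) $ l = 0" for l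
    using sum_nonneg_eq_0_iff[of UNIV "\<lambda>l. (x - axis i 1 - axis j 1) $ l"] by simp
  then have "x = axis i 1 + axis j 1"
    by (simp add: vec_eq_iff algebra_simps)
  then show thesis
    by (rule that)
qed

lemma exponent_point_mon2: "exponent_point (mon2 i j) = axis i 1 + axis j 1"
  by (simp add: exponent_point_def vec_eq_iff axis_def lookup_add lookup_single when_def)

lemma inj_exponent_point: "inj exponent_point"
  by (rule injI, rule poly_mapping_eqI) (simp add: exponent_point_def vec_eq_iff)

lemma exponent_in_two_simplex:
  assumes "exponent_point k \<in> two_simplex"
  shows "\<exists>i j. k = mon2 i j"
proof -
  obtain i j where "exponent_point k = axis i 1 + axis j 1"
    using lattice_point_two_simplex[OF assms] by (auto simp: exponent_point_def)
  then show ?thesis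
    unfolding exponent_point_mon2[symmetric] by (metis inj_exponent_point injD)
qed

section \<open>The space of polynomials with Newton polytope in a convex set\<close>

text \<open>A convex set contains the hull of the exponents as soon as it contains the exponents, so
  membership is tested monomial by monomial.\<close>

lemma polys_in_convex:
  assumes "convex M"
  shows "polys_in M = {p. \<forall>k\<in>Poly_Mapping.keys p. exponent_point k \<in> M}"
  using hull_subset[of "exponent_point ` Poly_Mapping.keys _" convex] assms
  unfolding polys_in_def newton_polytope_def
  by (auto simp: subset_hull)

lemma polys_in_eq_span:
  fixes M :: "(real ^ 'n::finite) set"
  assumes "convex M"
  shows "polys_in M = cpoly.span ((\<lambda>k. Poly_Mapping.single k 1) ` {k. exponent_point k \<in> M})"
    (is "_ = cpoly.span ?S")
proof
  show "polys_in M \<subseteq> cpoly.span ?S"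
  proof
    fix p assume p: "p \<in> polys_in M"
    have "cscale (Poly_Mapping.lookup p k) (Poly_Mapping.single k 1)
      = Poly_Mapping.single k (Poly_Mapping.lookup p k)" for k
      by (simp add: cscale_def Const_def mult_single)
    then have "p = (\<Sum>k\<in>Poly_Mapping.keys p. cscale (Poly_Mapping.lookup p k) (Poly_Mapping.single k 1))"
      by (intro poly_mapping_eqI) (auto simp: lookup_sum lookup_single when_def in_keys_iff)
    moreover have "\<dots> \<in> cpoly.span ?S"
      using p by (intro cpoly.span_sum cpoly.span_scale cpoly.span_base)
        (auto simp: polys_in_convex[OF assms])
    ultimately show "p \<in> cpoly.span ?S"
      by simp
  qed
  have "cpoly.subspace (polys_in M)"
    unfolding cpoly.subspace_def polys_in_convex[OF assms]
    by (auto simp: in_keys_iff cscale_lookup lookup_add)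
  then show "cpoly.span ?S \<subseteq> polys_in M"
    by (rule cpoly.span_minimal[rotated]) (auto simp: polys_in_convex[OF assms])
qed

lemma finite_exponents_two_simplex:
  fixes M :: "(real ^ 'n::finite) set"
  assumes "M \<subseteq> two_simplex"
  shows "finite {k :: 'n \<Rightarrow>\<^sub>0 nat. exponent_point k \<in> M}"
proof (rule finite_subset)
  show "{k :: 'n \<Rightarrow>\<^sub>0 nat. exponent_point k \<in> M} \<subseteq> (\<lambda>(i, j). mon2 i j) ` UNIV"
  proof
    fix k :: "'n \<Rightarrow>\<^sub>0 nat" assume "k \<in> {k. exponent_point k \<in> M}"
    then obtain i j where "k = mon2 i j"
      using assms exponent_in_two_simplex by blast
    then show "k \<in> (\<lambda>(i, j). mon2 i j) ` UNIV"
      by (auto simp del: One_nat_def)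
  qed
qed simp

section \<open>Symmetric weights with prescribed row sums\<close>

text \<open>Encodes \<open>x\<close> as a nonnegative combination of points e_i + e_j: an
  off-diagonal entry is the coefficient of its point, a diagonal entry twice the coefficient of 2
  e_i. The row sums are then the coordinates of \<open>x\<close>.\<close>

definition weighting :: "('n::finite \<times> 'n) set \<Rightarrow> real ^ 'n \<Rightarrow> real ^ 'n ^ 'n \<Rightarrow> bool"
  where "weighting E x W \<longleftrightarrow> (\<forall>i j. W $ i $ j = W $ j $ i \<and> 0 \<le> W $ i $ j \<and>
    (W $ i $ j \<noteq> 0 \<longrightarrow> (i, j) \<in> E)) \<and> (\<forall>i. (\<Sum>j\<in>UNIV. W $ i $ j) = x $ i)"

definition supp :: "real ^ 'n ^ 'n \<Rightarrow> ('n::finite \<times> 'n) set"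
  where "supp W = {(i, j). W $ i $ j \<noteq> 0}"

text \<open>The vectors that admit a weighting form a convex set, so it suffices to treat the single
  points of \<open>S\<close>.\<close>

lemma weighting_exists_convex_hull:
  fixes S :: "(real ^ 'n::finite) set"
  assumes S: "\<And>s. s \<in> S \<Longrightarrow> \<exists>i j. s = axis i 1 + axis j 1 \<and> (i, j) \<in> E \<and> (j, i) \<in> E"
    and x: "x \<in> convex hull S"
  shows "\<exists>W. weighting E x W"
proof -
  have "convex {x. \<exists>W. weighting E x W}"
  proof (rule convexI, safe)
    fix x y :: "real ^ 'n" and u v :: real and W V
    assume "weighting E x W" "weighting E y V" and uv: "0 \<le> u" "0 \<le> v" "u + v = 1"
    then have "weighting E (u *\<^sub>R x + v *\<^sub>R y) (u *\<^sub>R W + v *\<^sub>R V)"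
      unfolding weighting_def by (auto simp: sum.distrib simp flip: sum_distrib_left)
        (metis add.right_neutral mult_zero_right)+
    then show "\<exists>W. weighting E (u *\<^sub>R x + v *\<^sub>R y) W"
      by blast
  qed
  moreover have "S \<subseteq> {x. \<exists>W. weighting E x W}"
  proof safe
    fix s assume "s \<in> S"
    then obtain i j where s: "s = axis i 1 + axis j 1" and ij: "(i, j) \<in> E" "(j, i) \<in> E"
      using S by blast
    \<comment> \<open>For i = j the two summands coincide and give the diagonal entry 2, as the row
      sum of 2 e_i requires.\<close>
    have "weighting E s (axis i (axis j 1) + axis j (axis i 1))"
      unfolding weighting_def s using ij
      by (auto simp: axis_def sum.distrib if_distrib[of "\<lambda>v. v $ _"] cong: if_cong)
    then show "\<exists>W. weighting E s W"
      by blast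
  qed
  ultimately have "convex hull S \<subseteq> {x. \<exists>W. weighting E x W}"
    by (rule hull_minimal[rotated])
  then show ?thesis
    using x by blast
qed

lemma weighting_scale:
  assumes "weighting E x W" "0 \<le> c"
  shows "weighting E (c *\<^sub>R x) (c *\<^sub>R W)"
  using assms unfolding weighting_def by (simp flip: sum_distrib_left)

text \<open>Moving from \<open>W\<close> in the direction \<open>X\<close> keeps symmetry and row
  sums. The move stops when the first entry reaches 0; no entry outside the support of
  \<open>W\<close> is ever changed.\<close>

lemma weighting_smaller_support:
  assumes W: "weighting E x W" and sym: "\<And>i j. X $ i $ j = X $ j $ i"
    and supp: "supp X \<subseteq> supp W" and row: "\<And>i. (\<Sum>j\<in>UNIV. X $ i $ j) = 0" and "X \<noteq> 0"
  shows "\<exists>V. weighting E x V \<and> supp V \<subset> supp W"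
proof -
  let ?N = "{(i, j). X $ i $ j < 0}" and ?q = "\<lambda>(i, j). W $ i $ j / - X $ i $ j"
  obtain a b where "X $ a $ b \<noteq> 0"
    using \<open>X \<noteq> 0\<close> by (auto simp: vec_eq_iff)
  \<comment> \<open>A row with sum 0 and a nonzero entry must also have a negative entry.\<close>
  then have "\<exists>j. X $ a $ j < 0"
    using row[of a] sum_nonneg_eq_0_iff[of UNIV "\<lambda>j. X $ a $ j"]
    by (metis UNIV_I finite_class.finite_UNIV not_le)
  then have "?N \<noteq> {}"
    by auto
  then obtain c d where cd: "X $ c $ d < 0" and
    min: "\<And>i j. X $ i $ j < 0 \<Longrightarrow> ?q (c, d) \<le> ?q (i, j)"
    using ex_is_arg_min_if_finite[of ?N ?q] by (auto simp: is_arg_min_linorder)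
  \<comment> \<open>The largest step that keeps all entries nonnegative; it annihilates the entry at
    (c, d).\<close>
  define t where "t = ?q (c, d)"
  have W0: "0 \<le> W $ i $ j" for i j
    using W by (simp add: weighting_def)
  have t: "0 \<le> t"
    using cd W0[of c d] by (simp add: t_def divide_nonneg_neg)
  have nonneg: "0 \<le> W $ i $ j + t * X $ i $ j" for i j
  proof (cases "X $ i $ j < 0")
    case True
    then show ?thesis
      using min[OF True] by (simp add: t_def[simplified, symmetric] field_simps)
  next
    case False
    then show ?thesis
      using t W0[of i j] by simp
  qed
  have sub: "W $ i $ j = 0 \<Longrightarrow> X $ i $ j = 0" for i j
    using supp by (auto simp: supp_def)
  have "weighting E x (W + t *\<^sub>R X)"
    unfolding weighting_def
  proof (intro conjI allI impI)
    fix i j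
    show "(W + t *\<^sub>R X) $ i $ j = (W + t *\<^sub>R X) $ j $ i"
      using W sym[of i j] by (simp add: weighting_def)
    show "0 \<le> (W + t *\<^sub>R X) $ i $ j"
      using nonneg by simp
    show "(i, j) \<in> E" if "(W + t *\<^sub>R X) $ i $ j \<noteq> 0"
      using that W sub[of i j] by (cases "W $ i $ j = 0") (auto simp: weighting_def)
    show "(\<Sum>j\<in>UNIV. (W + t *\<^sub>R X) $ i $ j) = x $ i"
      using W row[of i] unfolding weighting_def
      by (auto simp: sum.distrib simp flip: sum_distrib_left)
  qed
  moreover have "supp (W + t *\<^sub>R X) \<subseteq> supp W - {(c, d)}"
    using sub cd by (auto simp: supp_def t_def)
  moreover have "(c, d) \<in> supp W"
    using cd sub[of c d] by (auto simp: supp_def)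
  ultimately show ?thesis
    by blast
qed

section \<open>Nonsingularity of weightings of minimal support\<close>

text \<open>The matrices supported on \<open>R\<close> form a space of dimension \<open>card R\<close>, whereas the vectors of
  marginals lie in a hyperplane of a space of dimension \<open>card U + card N\<close>, because row sums and
  column sums have the same total.\<close>

lemma zero_marginals_exists:
  fixes R :: "('n::finite \<times> 'n) set"
  assumes R: "R \<subseteq> U \<times> N" and disj: "U \<inter> N = {}" and "U \<noteq> {}"
    and card: "card U + card N \<le> card R"
  shows "\<exists>Y :: real ^ 'n ^ 'n. Y \<noteq> 0 \<and> supp Y \<subseteq> R \<and>
    (\<forall>i. (\<Sum>j\<in>UNIV. Y $ i $ j) = 0) \<and> (\<forall>j. (\<Sum>i\<in>UNIV. Y $ i $ j) = 0)"
proof -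
  let ?e = "\<lambda>(i, j). axis i (axis j 1) :: real ^ 'n ^ 'n"
  \<comment> \<open>One vector stores both kinds of marginals: for \<open>Y\<close> supported in
    \<open>U\<close> x \<open>N\<close> with \<open>U\<close> and \<open>N\<close> disjoint, an
    index in \<open>U\<close> sees only its row sum and an index in \<open>N\<close> only its column
    sum.\<close>
  define L where "L = (\<lambda>Y :: real ^ 'n ^ 'n. \<chi> l. (\<Sum>j\<in>UNIV. Y $ l $ j) + (\<Sum>i\<in>UNIV. Y $ i $ l))"
  let ?T = "span (?e ` R)" and ?A = "(\<lambda>i :: 'n. axis i (1 :: real)) ` (U \<union> N)"
  let ?H = "{v :: real ^ 'n. (\<forall>l. l \<notin> U \<union> N \<longrightarrow> v $ l = 0) \<and> (\<Sum>i\<in>U. v $ i) = (\<Sum>j\<in>N. v $ j)}"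
  have inj_e: "inj ?e"
    by (auto simp: inj_def axis_eq_axis)
  have "?e ` R \<subseteq> Basis"
    by (auto simp: Basis_vec_def)
  then have dimT: "dim ?T = card R"
    using inj_e by (simp add: dim_span dim_eq_card_independent independent_mono[OF independent_Basis]
        card_image inj_on_subset)
  have suppT: "supp Y \<subseteq> R" if "Y \<in> ?T" for Y
  proof -
    have "?T \<subseteq> {Y. \<forall>i j. (i, j) \<notin> R \<longrightarrow> Y $ i $ j = 0}"
      by (rule span_minimal) (auto simp: subspace_def axis_def)
    with that show ?thesis
      by (auto simp: supp_def)
  qed
  have linL: "linear L"
    by (rule linearI) (simp_all add: L_def vec_eq_iff sum.distrib sum_distrib_left algebra_simps)
  have rows: "(\<Sum>j\<in>UNIV. Y $ i $ j) = 0" if "supp Y \<subseteq> R" "i \<notin> U" for Y :: "real ^ 'n ^ 'n" and i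
    using that R by (intro sum.neutral) (auto simp: supp_def)
  have cols: "(\<Sum>i\<in>UNIV. Y $ i $ j) = 0" if "supp Y \<subseteq> R" "j \<notin> N" for Y :: "real ^ 'n ^ 'n" and j
    using that R by (intro sum.neutral) (auto simp: supp_def)
  have LU: "L Y $ i = (\<Sum>j\<in>UNIV. Y $ i $ j)" if "supp Y \<subseteq> R" "i \<notin> N" for Y i
    using cols[OF that] by (simp add: L_def)
  have LN: "L Y $ j = (\<Sum>i\<in>UNIV. Y $ i $ j)" if "supp Y \<subseteq> R" "j \<notin> U" for Y j
    using rows[OF that] by (simp add: L_def)
  have "L ` ?T \<subseteq> ?H"
  proof (intro image_subsetI CollectI conjI allI impI)
    fix Y assume "Y \<in> ?T"
    then have Y: "supp Y \<subseteq> R"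
      by (rule suppT)
    show "L Y $ l = 0" if "l \<notin> U \<union> N" for l
      using that LU[OF Y, of l] rows[OF Y, of l] by simp
    \<comment> \<open>Both sides are the total of all entries of \<open>Y\<close>.\<close>
    have "(\<Sum>i\<in>U. L Y $ i) = (\<Sum>i\<in>U. \<Sum>j\<in>UNIV. Y $ i $ j)"
      using disj by (intro sum.cong refl LU[OF Y]) auto
    also have "\<dots> = (\<Sum>i\<in>UNIV. \<Sum>j\<in>UNIV. Y $ i $ j)"
      by (rule sum.mono_neutral_left) (auto simp: rows[OF Y])
    also have "\<dots> = (\<Sum>j\<in>UNIV. \<Sum>i\<in>UNIV. Y $ i $ j)"
      by (rule sum.swap)
    also have "\<dots> = (\<Sum>j\<in>N. \<Sum>i\<in>UNIV. Y $ i $ j)"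
      by (rule sum.mono_neutral_right) (auto simp: cols[OF Y])
    also have "\<dots> = (\<Sum>j\<in>N. L Y $ j)"
      using disj by (intro sum.cong refl LN[OF Y, symmetric]) auto
    finally show "(\<Sum>i\<in>U. L Y $ i) = (\<Sum>j\<in>N. L Y $ j)" .
  qed
  moreover have "dim ?H < card U + card N"
  proof -
    have subH: "subspace ?H"
      by (auto simp: subspace_def sum.distrib simp flip: sum_distrib_left)
    have A: "?A \<subseteq> Basis"
      by (auto simp: Basis_vec_def)
    have "dim ?A = card ?A"
      by (rule dim_eq_card_independent) (rule independent_mono[OF independent_Basis A])
    also have "\<dots> = card U + card N"
      using disj by (subst card_image) (auto simp: inj_on_def axis_eq_axis card_Un_disjoint)
    finally have dimA: "dim (span ?A) = card U + card N"
      by (simp add: dim_span)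
    have "?H \<subseteq> span ?A"
    proof
      fix v assume v: "v \<in> ?H"
      have "v = (\<Sum>l\<in>U \<union> N. (v $ l) *\<^sub>R axis l 1)"
        using v by (auto simp: vec_eq_iff axis_def if_distrib[of "\<lambda>a. _ * a"] cong: if_cong)
      also have "\<dots> \<in> span ?A"
        by (intro span_sum span_scale span_base) auto
      finally show "v \<in> span ?A" .
    qed
    moreover obtain a where a: "a \<in> U"
      using \<open>U \<noteq> {}\<close> by blast
    have "axis a 1 \<in> span ?A"
      using a by (intro span_base) auto
    \<comment> \<open>A unit vector at an index of \<open>U\<close> violates the balance between
      \<open>U\<close> and \<open>N\<close>, so \<open>?H\<close> is a proper subspace and one
      dimension is lost.\<close>
    moreover have "axis a 1 \<notin> ?H"
    proof -
      have "(\<Sum>i\<in>U. axis a 1 $ i) = (1::real)"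
        using a by (simp add: axis_def)
      moreover have "(\<Sum>j\<in>N. axis a 1 $ j) = (0::real)"
        using a disj by (intro sum.neutral) (auto simp: axis_def)
      ultimately show ?thesis
        by simp
    qed
    ultimately have "?H \<subset> span ?A"
      by blast
    then have "dim ?H < dim (span ?A)"
      using subH by (intro dim_psubset) (simp add: span_eq_iff[THEN iffD2])
    then show ?thesis
      using dimA by linarith
  qed
  ultimately have "dim (L ` ?T) < dim ?T"
    using dim_subset[of "L ` ?T" ?H] card dimT by linarith
  then have "\<not> inj_on L (span ?T)"
    using dim_image_eq[OF linL, of ?T] by auto
  then obtain Y where Y: "Y \<in> ?T" "L Y = 0" "Y \<noteq> 0"
    using linear_inj_on_iff_eq_0[OF linL, of ?T] by (auto simp: span_span subspace_span)
  have sY: "supp Y \<subseteq> R"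
    by (rule suppT[OF Y(1)])
  have "(\<Sum>j\<in>UNIV. Y $ i $ j) = 0" for i
    using LU[OF sY, of i] rows[OF sY, of i] Y(2) disj by (cases "i \<in> U") auto
  moreover have "(\<Sum>i\<in>UNIV. Y $ i $ j) = 0" for j
    using LN[OF sY, of j] cols[OF sY, of j] Y(2) disj by (cases "j \<in> N") auto
  ultimately show ?thesis
    using Y(3) sY by blast
qed

text \<open>Counting edges from either side gives \<open>2 * card U\<close> and
  \<open>2 * card N\<close> as lower bounds for \<open>card R\<close>; their average is the
  claim.\<close>

lemma card_relation_ge:
  fixes R :: "('n::finite \<times> 'n) set"
  assumes "R \<subseteq> U \<times> N"
    and "\<And>i. i \<in> U \<Longrightarrow> \<exists>j j'. j \<noteq> j' \<and> (i, j) \<in> R \<and> (i, j') \<in> R"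
    and "\<And>j. j \<in> N \<Longrightarrow> \<exists>i i'. i \<noteq> i' \<and> (i, j) \<in> R \<and> (i', j) \<in> R"
  shows "card U + card N \<le> card R"
proof -
  have two: "2 \<le> card A" if "a \<noteq> b" "a \<in> A" "b \<in> A" for a b :: 'n and A
    using card_mono[of A "{a, b}"] that by auto
  have "R = (SIGMA i:U. {j. (i, j) \<in> R})"
    using assms(1) by auto
  then have "card R = (\<Sum>i\<in>U. card {j. (i, j) \<in> R})"
    by (metis (no_types, lifting) card_SigmaI finite sum.cong)
  also have "\<dots> \<ge> (\<Sum>i\<in>U. 2)"
    using assms(2) two by (intro sum_mono) (metis mem_Collect_eq)
  finally have U: "2 * card U \<le> card R"
    by simp
  have "R\<inverse> = (SIGMA j:N. {i. (i, j) \<in> R})"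
    using assms(1) by auto
  then have "card R = (\<Sum>j\<in>N. card {i. (i, j) \<in> R})"
    by (metis (no_types, lifting) card_SigmaI card_inverse finite sum.cong)
  also have "\<dots> \<ge> (\<Sum>j\<in>N. 2)"
    using assms(3) two by (intro sum_mono) (metis mem_Collect_eq)
  finally show ?thesis
    using U by simp
qed

lemma weighting_singular_smaller_support:
  fixes W :: "real ^ 'n::finite ^ 'n"
  assumes W: "weighting E 1 W" and det: "det W = 0"
  shows "\<exists>V. weighting E 1 V \<and> supp V \<subset> supp W"
proof -
  have W0: "0 \<le> W $ i $ j" and sym: "W $ i $ j = W $ j $ i" and row: "(\<Sum>j\<in>UNIV. W $ i $ j) = 1" for i j
    using W unfolding weighting_def by auto
  have "\<not> invertible W"
    using det by (simp add: invertible_det_nz)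
  then obtain u where u: "W *v u = 0" "u \<noteq> 0"
    using matrix_left_invertible_ker[of W] invertible_left_inverse by blast
  have Wu: "(\<Sum>j\<in>UNIV. W $ i $ j * u $ j) = 0" for i
    using arg_cong[OF u(1), of "\<lambda>v. v $ i"] by (simp add: matrix_vector_mult_def)
  show ?thesis
  proof (cases "\<exists>i j. u $ i * u $ j * W $ i $ j \<noteq> 0")
    case True
    let ?X = "\<chi> i j. u $ i * u $ j * W $ i $ j"
    \<comment> \<open>This is u_i times the i-th coordinate of \<open>W *v u\<close>, which is
      0.\<close>
    have "(\<Sum>j\<in>UNIV. ?X $ i $ j) = u $ i * (\<Sum>j\<in>UNIV. W $ i $ j * u $ j)" for i
      by (simp add: sum_distrib_left ac_simps)
    then have "(\<Sum>j\<in>UNIV. ?X $ i $ j) = 0" for i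
      by (simp only: Wu mult_zero_right)
    then show ?thesis
      using True by (intro weighting_smaller_support[OF W, of ?X])
        (auto simp: sym supp_def vec_eq_iff mult.commute)
  next
    case False
    define U where "U = {i. u $ i \<noteq> 0}"
    define N where "N = {j. \<exists>i\<in>U. W $ i $ j \<noteq> 0}"
    define R where "R = {(i, j). i \<in> U \<and> W $ i $ j \<noteq> 0}"
    \<comment> \<open>In this case \<open>W\<close> vanishes on \<open>U\<close> x \<open>U\<close>,
      so no neighbour of a vertex of \<open>U\<close> lies in \<open>U\<close>.\<close>
    have disj: "U \<inter> N = {}"
      using False by (auto simp: U_def N_def)
    have "U \<noteq> {}"
      using u(2) by (auto simp: U_def vec_eq_iff)
    have RUN: "R \<subseteq> U \<times> N"
      by (auto simp: R_def N_def)
    \<comment> \<open>If i were the only neighbour of j in \<open>U\<close>, the j-th coordinate of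
      \<open>W *v u\<close> would be the single nonzero term W_ji u_i.\<close>
    have col2: "\<exists>i'. i' \<noteq> i \<and> i' \<in> U \<and> W $ i' $ j \<noteq> 0" if "i \<in> U" "W $ i $ j \<noteq> 0" for i j
    proof (rule ccontr)
      assume "\<not> ?thesis"
      then have "(\<Sum>l\<in>UNIV. W $ j $ l * u $ l) = (\<Sum>l\<in>{i}. W $ j $ l * u $ l)"
        by (intro sum.mono_neutral_right) (auto simp: U_def sym[of j])
      then show False
        using Wu[of j] that by (simp add: U_def sym[of j])
    qed
    \<comment> \<open>If j were the only neighbour of i, the edge would have weight 1 and use up the
      row sum of j, leaving nothing for the second neighbour supplied by
      \<open>col2\<close>.\<close>
    have row2: "\<exists>j'. j' \<noteq> j \<and> W $ i $ j' \<noteq> 0" if ij: "i \<in> U" "W $ i $ j \<noteq> 0" for i j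
    proof (rule ccontr)
      assume "\<not> ?thesis"
      then have "(\<Sum>l\<in>UNIV. W $ i $ l) = (\<Sum>l\<in>{j}. W $ i $ l)"
        by (intro sum.mono_neutral_right) auto
      then have "W $ j $ i = 1"
        using row[of i] by (simp add: sym[of j])
      obtain i' where i': "i' \<noteq> i" "W $ i' $ j \<noteq> 0"
        using col2[OF ij] by blast
      have "(\<Sum>l\<in>{i, i'}. W $ j $ l) \<le> (\<Sum>l\<in>UNIV. W $ j $ l)"
        by (rule sum_mono2) (auto simp: W0)
      then show False
        using i' \<open>W $ j $ i = 1\<close> row[of j] W0[of j i'] sym[of j i'] by simp
    qed
    \<comment> \<open>Row sum 1 provides a first neighbour; \<open>row2\<close> then provides a
      second.\<close>
    have "\<exists>j. W $ i $ j \<noteq> 0" for i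
      using row[of i] by (metis sum.neutral zero_neq_one)
    then have "card U + card N \<le> card R"
      using row2 col2 by (intro card_relation_ge[OF RUN]) (fastforce simp: R_def N_def)+
    then obtain Y :: "real ^ 'n ^ 'n" where Y: "Y \<noteq> 0" "supp Y \<subseteq> R"
      "\<And>i. (\<Sum>j\<in>UNIV. Y $ i $ j) = 0" "\<And>j. (\<Sum>i\<in>UNIV. Y $ i $ j) = 0"
      using zero_marginals_exists[OF RUN disj \<open>U \<noteq> {}\<close>] by blast
    have YR: "(i, j) \<in> R" if "Y $ i $ j \<noteq> 0" for i j
      using Y(2) that by (auto simp: supp_def)
    \<comment> \<open>\<open>Y\<close> lives on \<open>U\<close> x \<open>N\<close> and its
      transpose on \<open>N\<close> x \<open>U\<close>, so nothing cancels. The row sums of the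
      symmetrization are row sums plus column sums of \<open>Y\<close>, which is why both marginals
      must vanish.\<close>
    have "Y + transpose Y \<noteq> 0"
    proof -
      obtain i j where ij: "Y $ i $ j \<noteq> 0"
        using Y(1) by (auto simp: vec_eq_iff)
      then have "(j, i) \<notin> R"
        using YR RUN disj by blast
      then have "(Y + transpose Y) $ i $ j \<noteq> 0"
        using ij YR[of j i] by (auto simp: transpose_def)
      then show ?thesis
        by (metis zero_index)
    qed
    moreover have "supp (Y + transpose Y) \<subseteq> supp W"
    proof safe
      fix i j assume "(i, j) \<in> supp (Y + transpose Y)"
      then have "(i, j) \<in> R \<or> (j, i) \<in> R"
        using YR[of i j] YR[of j i]
        by (cases "Y $ i $ j = 0") (auto simp: supp_def transpose_def)
      then show "(i, j) \<in> supp W"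
        using sym[of i j] by (auto simp: supp_def R_def)
    qed
    ultimately show ?thesis
      by (intro weighting_smaller_support[OF W, of "Y + transpose Y"])
        (simp_all add: transpose_def sum.distrib Y)
  qed
qed

text \<open>A weighting whose support has least cardinality cannot be singular, since a singular one
  admits a weighting of strictly smaller support.\<close>

lemma nonsingular_weighting_exists:
  fixes E :: "('n::finite \<times> 'n) set"
  assumes "weighting E 1 W"
  obtains V where "weighting E 1 V" "det V \<noteq> 0"
proof -
  obtain V where V: "weighting E 1 V" "\<And>V'. weighting E 1 V' \<Longrightarrow> card (supp V) \<le> card (supp V')"
    using assms arg_min_nat_lemma[of "weighting E 1" W "\<lambda>V. card (supp V)"] by metis
  then have "det V \<noteq> 0"
    using weighting_singular_smaller_support psubset_card_mono[of "supp V"]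
    by (metis finite not_le)
  with V(1) show thesis
    by (rule that)
qed

section \<open>Generic nondegeneracy of the forms with Newton polytope in \<open>M\<close>\<close>

lemma det_of_real:
  fixes A :: "real ^ 'n ^ 'n"
  shows "det (\<chi> i j. complex_of_real (A $ i $ j)) = complex_of_real (det A)"
  by (simp add: det_def)

theorem theorem2:
  fixes M :: "(real ^ 'n::finite) set"
  assumes "lattice_polytope M"
    and "M \<subseteq> two_simplex"
    and "(\<chi> i. 2 / real CARD('n)) \<in> M"
  shows "(\<exists>S. finite S \<and> cpoly.span S = polys_in M) \<and>
    (\<forall>B \<in> polys_in M. quadratic_form B) \<and>
    algebraic_subset cscale (polys_in M) {B \<in> polys_in M. degenerate B} \<and>
    {B \<in> polys_in M. degenerate B} \<subset> polys_in M"
proof -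
  obtain S where S: "\<And>x i. x \<in> S \<Longrightarrow> x $ i \<in> \<int>" "M = convex hull S"
    using assms(1) by (auto simp: lattice_polytope_def)
  have conv: "convex M"
    by (simp add: S(2))
  have quad: "quadratic_form p" if "p \<in> polys_in M" for p
  proof -
    have "\<exists>i j. k = mon2 i j" if "k \<in> Poly_Mapping.keys p" for k
      using \<open>p \<in> polys_in M\<close> that assms(2) exponent_in_two_simplex
      unfolding polys_in_convex[OF conv] by blast
    then have "form_of_matrix (matrix_of_form p) = p"
      by (rule form_of_matrix_of_form)
    then show ?thesis
      unfolding quadratic_form_def by (metis matrix_of_form_symmetric)
  qed
  have "\<exists>S. finite S \<and> cpoly.span S = polys_in M"
    using polys_in_eq_span[OF conv] finite_exponents_two_simplex[OF assms(2)] by blast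
  \<comment> \<open>The degenerate locus is cut out by the determinant alone.\<close>
  moreover have "algebraic_subset cscale (polys_in M) {B \<in> polys_in M. degenerate B}"
    unfolding algebraic_subset_def
    using polynomial_functions_det_matrix_of_form degenerate_iff_det[OF quad]
    by (intro exI[of _ "{\<lambda>p. det (matrix_of_form p)}"]) auto
  \<comment> \<open>Properness needs one nondegenerate form in the space; it comes from a
    nonsingular weighting.\<close>
  moreover have "\<exists>p \<in> polys_in M. \<not> degenerate p"
  proof -
    define E :: "('n \<times> 'n) set" where "E = {(i, j). axis i 1 + axis j 1 \<in> M}"
    have "\<exists>i j. s = axis i 1 + axis j 1 \<and> (i, j) \<in> E \<and> (j, i) \<in> E" if "s \<in> S" for s
    proof -
      have "s \<in> M"
        using that by (simp add: S(2) hull_inc)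
      then show ?thesis
        using lattice_point_two_simplex[of s] S(1)[OF that] assms(2)
        by (auto simp: E_def) (metis add.commute in_mono)
    qed
    then obtain W where "weighting E (\<chi> i. 2 / real CARD('n)) W"
      using weighting_exists_convex_hull[of S E] assms(3) S(2) by blast
    \<comment> \<open>The factor n/2 turns the row sums 2/n into 1.\<close>
    then have "weighting E ((real CARD('n) / 2) *\<^sub>R (\<chi> i. 2 / real CARD('n))) ((real CARD('n) / 2) *\<^sub>R W)"
      by (rule weighting_scale) simp
    also have "(real CARD('n) / 2) *\<^sub>R (\<chi> i. 2 / real CARD('n)) = (1 :: real ^ 'n)"
      by (simp add: vec_eq_iff)
    finally obtain V where V: "weighting E 1 V" "det V \<noteq> 0"
      by (rule nonsingular_weighting_exists)
    define B where "B = (\<chi> i j. complex_of_real (V $ i $ j))"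
    have "transpose B = B" "det B \<noteq> 0"
      using V by (simp_all add: B_def det_of_real transpose_def weighting_def vec_eq_iff)
    then have "\<not> degenerate (form_of_matrix B)"
      unfolding degenerate_def nondegenerate_def by blast
    moreover have "form_of_matrix B \<in> polys_in M"
      unfolding polys_in_convex[OF conv]
    proof safe
      fix k assume "k \<in> Poly_Mapping.keys (form_of_matrix B)"
      \<comment> \<open>A nonzero coefficient needs a nonzero entry of \<open>B\<close>, hence of
        \<open>V\<close>, and the support of \<open>V\<close> lies in \<open>E\<close>.\<close>
      then obtain i j where "k = mon2 i j" "B $ i $ j \<noteq> 0"
        unfolding in_keys_iff lookup_form_of_matrix
        by (auto elim!: sum.not_neutral_contains_not_neutral split: if_splits simp del: One_nat_def)
      then show "exponent_point k \<in> M"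
        using V(1) by (auto simp: B_def weighting_def E_def exponent_point_mon2 simp del: One_nat_def)
    qed
    ultimately show ?thesis
      by blast
  qed
  ultimately show ?thesis
    using quad by blast
qed

end
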